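(* Let $\mathcal S$ be a minors system with Hopf algebra $\mathcal H$, let $\{S_i\}_{i\in I}=\mathcal S_1$, and suppose that for each $j$ in an index set $J$ there are a function $r_j:\mathcal S\to\mathbb Q$ and rationals $m_{ij}$ with $r_j(S)=0$ for $S\in\mathcal S_0$ and $r_j(S)=r_j(S/\!/e)+m_{ij}$ whenever $e\in E(S)$ and $\delta_i(S\backslash\!\backslash(E(S)\setminus\{e\}))=1$. Let $\delta_{\mathbf a}=\sum_i(\prod_j x_j^{m_{ij}})\delta_i$ and $\delta_{\mathbf b}=\sum_i(\prod_j y_j^{m_{ij}})\delta_i$. Suppose $J_X,J_Y,J_Z$ partition $J$, and let $\delta_{\mathbf a'}$, $\delta_{\mathbf b'}$ be obtained from $\delta_{\mathbf a}$, $\delta_{\mathbf b}$ by setting $x_j=1$ for $j\in J_X$ and $y_j=1$ for $j\in J_Y$. Then there is a unique, well-defined polynomial invariant $\alpha$ on $\mathcal S$ given by $\alpha(S)=1$ for $S\in\mathcal S_0$ and, for $S\notin\mathcal S_0$ and any $e\in E(S)$, $$\alpha(S)=\delta_{\mathbf b}\big(S/\!/(E(S)\setminus\{e\})\big)\,\alpha(S\backslash\!\backslash e)+\delta_{\mathbf a}\big(S\backslash\!\backslash(E(S)\setminus\{e\})\big)\,\alpha(S/\!/e).$$ Moreover $$\alpha(S)=\Big(\prod_{j\in J_X}x_j^{r_j(S)}\Big)\Big(\prod_{j\in J_Y}y_j^{r_j(S)}\Big)\,\alpha'(\mathbf a',\mathbf b')(S)\Big|_{y_j\mapsto y_j/x_j\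 (j\in J_X),\ x_j\mapsto x_j/y_j\ (j\in J_Y)},$$ where $\alpha'(\mathbf a',\mathbf b')=\exp_*(\delta_{\mathbf a'})*\exp_*(\delta_{\mathbf b'})$ is the canonical Tutte polynomial of $\mathcal H$ defined by $\delta_{\mathbf a'}$ and $\delta_{\mathbf b'}$.
   Context: A minors system: graded set $\mathcal S=\bigcup_{n\ge0}\mathcal S_n$, each $S\in\mathcal S_n$ with a set $E(S)$ of $n$ elements, unique $1\in\mathcal S_0$, operations $S\backslash\!\backslash e$, $S/\!/e$ with $E(S\backslash\!\backslash e)=E(S/\!/e)=E(S)\setminus\{e\}$, operations on distinct elements commuting; $S\backslash\!\backslash A$, $S/\!/A$ apply them to all of $A$. Its Hopf algebra $\mathcal H$ is the free module with basis $\mathcal S$ (over a field of characteristic 0), graded by $|E(S)|$, with coproduct $\Delta(S)=\sum_{A\subseteq E(S)}(S\backslash\!\backslash A^c)\otimes(S/\!/A)$, counit $1$ on $\mathcal S_0$ and $0$ otherwise, and a multiplication with unit $1$, additive on $E$ and compatible with both minor operations. $\delta_i$ is the linear map with $\delta_i(S_i)=1$ and $0$ on all other elements of $\mathcal S$. $f*g=m\circ(f\otimes g)\circ\Delta$, $\exp_*(\delta)=\sum_{k\ge0}\delta^{*k}/k!$ with $\delta^{*0}=\varepsilon$. *)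

theory Defs
  imports Complex_Main "HOL-Library.FuncSet" "HOL-Library.Poly_Mapping"
begin

section \<open>Minors systems\<close>

record ('s, 'e) minors =
  grade :: "nat \<Rightarrow> 's set"
  unit_elt :: 's
  ground :: "'s \<Rightarrow> 'e set"
  del :: "'s \<Rightarrow> 'e \<Rightarrow> 's"
  con :: "'s \<Rightarrow> 'e \<Rightarrow> 's"
  mul :: "'s \<Rightarrow> 's \<Rightarrow> 's"

definition elts :: "('s, 'e) minors \<Rightarrow> 's set" where
  "elts M = (\<Union>n. grade M n)"

locale minors_system =
  fixes M :: "('s, 'e) minors"
  assumes ground_finite: "S \<in> grade M n \<Longrightarrow> finite (ground M S)"
    and ground_card: "S \<in> grade M n \<Longrightarrow> card (ground M S) = n"
    and grade_0: "grade M 0 = {unit_elt M}"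
    and del_closed: "S \<in> elts M \<Longrightarrow> e \<in> ground M S \<Longrightarrow> del M S e \<in> elts M"
    and con_closed: "S \<in> elts M \<Longrightarrow> e \<in> ground M S \<Longrightarrow> con M S e \<in> elts M"
    and ground_del: "S \<in> elts M \<Longrightarrow> e \<in> ground M S \<Longrightarrow> ground M (del M S e) = ground M S - {e}"
    and ground_con: "S \<in> elts M \<Longrightarrow> e \<in> ground M S \<Longrightarrow> ground M (con M S e) = ground M S - {e}"
    and del_del: "\<lbrakk>S \<in> elts M; e \<in> ground M S; f \<in> ground M S; e \<noteq> f\<rbrakk>
      \<Longrightarrow> del M (del M S e) f = del M (del M S f) e"
    and con_con: "\<lbrakk>S \<in> elts M; e \<in> ground M S; f \<in> ground M S; e \<noteq> f\<rbrakk>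
      \<Longrightarrow> con M (con M S e) f = con M (con M S f) e"
    and del_con: "\<lbrakk>S \<in> elts M; e \<in> ground M S; f \<in> ground M S; e \<noteq> f\<rbrakk>
      \<Longrightarrow> con M (del M S e) f = del M (con M S f) e"

text \<open>
  Additivity of the ground set means that the ground set of a product is the disjoint union of the
  ground sets of the factors. As the ground sets are honest sets, the product is constrained
  exactly where this makes sense, that is for factors with disjoint ground sets. (Minor operations
  remove elements from the ground set on the nose, so a product that is required to be additive,
  unital and compatible with minors on all pairs exists only if all ground sets are empty.)
\<close>

locale minors_system_mult = minors_system M for M :: "('s, 'e) minors" +
  assumes mul_closed: "\<lbrakk>S \<in> elts M; T \<in> elts M; ground M S \<inter> ground M T = {}\<rbrakk>
      \<Longrightarrow> mul M S T \<in> elts M"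
    and mul_unit_left: "S \<in> elts M \<Longrightarrow> mul M (unit_elt M) S = S"
    and mul_unit_right: "S \<in> elts M \<Longrightarrow> mul M S (unit_elt M) = S"
    and mul_assoc: "\<lbrakk>S \<in> elts M; T \<in> elts M; U \<in> elts M; ground M S \<inter> ground M T = {};
      ground M S \<inter> ground M U = {}; ground M T \<inter> ground M U = {}\<rbrakk>
      \<Longrightarrow> mul M (mul M S T) U = mul M S (mul M T U)"
    and ground_mul: "\<lbrakk>S \<in> elts M; T \<in> elts M; ground M S \<inter> ground M T = {}\<rbrakk>
      \<Longrightarrow> ground M (mul M S T) = ground M S \<union> ground M T"
    and del_mul_left: "\<lbrakk>S \<in> elts M; T \<in> elts M; ground M S \<inter> ground M T = {}; e \<in> ground M S\<rbrakk>
      \<Longrightarrow> del M (mul M S T) e = mul M (del M S e) T"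
    and del_mul_right: "\<lbrakk>S \<in> elts M; T \<in> elts M; ground M S \<inter> ground M T = {}; e \<in> ground M T\<rbrakk>
      \<Longrightarrow> del M (mul M S T) e = mul M S (del M T e)"
    and con_mul_left: "\<lbrakk>S \<in> elts M; T \<in> elts M; ground M S \<inter> ground M T = {}; e \<in> ground M S\<rbrakk>
      \<Longrightarrow> con M (mul M S T) e = mul M (con M S e) T"
    and con_mul_right: "\<lbrakk>S \<in> elts M; T \<in> elts M; ground M S \<inter> ground M T = {}; e \<in> ground M T\<rbrakk>
      \<Longrightarrow> con M (mul M S T) e = mul M S (con M T e)"

text \<open>The folds do not depend on the order for \<open>A \<subseteq> ground M S\<close> because minor operations on distinct
  elements commute.\<close>

definition del_set :: "('s, 'e) minors \<Rightarrow> 's \<Rightarrow> 'e set \<Rightarrow> 's" where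
  "del_set M S A = Finite_Set.fold (\<lambda>e T. del M T e) S A"

definition con_set :: "('s, 'e) minors \<Rightarrow> 's \<Rightarrow> 'e set \<Rightarrow> 's" where
  "con_set M S A = Finite_Set.fold (\<lambda>e T. con M T e) S A"

section \<open>Free modules and linear maps\<close>

text \<open>
  The free module with basis \<open>'s\<close> over the field \<open>'k\<close> is the type \<^typ>\<open>'s \<Rightarrow>\<^sub>0 'k\<close>, and the tensor
  product of two free modules is the free module on the pairs of basis elements. The Hopf algebra
  of \<open>M\<close> is the submodule with basis \<^term>\<open>elts M\<close>.
\<close>

definition basis_elt :: "'s \<Rightarrow> 's \<Rightarrow>\<^sub>0 'k::field_char_0" where
  "basis_elt S = Poly_Mapping.single S 1"

definition scale :: "'k \<Rightarrow> ('b \<Rightarrow>\<^sub>0 'k) \<Rightarrow> ('b \<Rightarrow>\<^sub>0 'k::field_char_0)" where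
  "scale c p = Poly_Mapping.map ((*) c) p"

definition linear_extension :: "('s \<Rightarrow> 'b \<Rightarrow>\<^sub>0 'k) \<Rightarrow> ('s \<Rightarrow>\<^sub>0 'k) \<Rightarrow> ('b \<Rightarrow>\<^sub>0 'k::field_char_0)" where
  "linear_extension g h = (\<Sum>S\<in>Poly_Mapping.keys h. scale (Poly_Mapping.lookup h S) (g S))"

text \<open>The linear functional that is 1 on the basis element \<open>S\<close> and 0 on all other basis elements.\<close>

definition dual :: "'s \<Rightarrow> ('s \<Rightarrow>\<^sub>0 'k) \<Rightarrow> 'k::field_char_0" where
  "dual S h = Poly_Mapping.lookup h S"

section \<open>Polynomials with rational exponents\<close>

datatype 'j indet = X 'j | Y 'j

text \<open>
  The group algebra over \<open>'k\<close> of the additive group of finitely supported rational exponent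
  vectors; multiplication on \<open>\<Rightarrow>\<^sub>0\<close> is convolution, so the product of monomials adds exponents.
\<close>

type_synonym ('v, 'k) qpoly = "('v \<Rightarrow>\<^sub>0 rat) \<Rightarrow>\<^sub>0 'k"

definition indet_pow :: "'v \<Rightarrow> rat \<Rightarrow> ('v, 'k::field_char_0) qpoly" where
  "indet_pow t q = Poly_Mapping.single (Poly_Mapping.single t q) 1"

text \<open>The product over \<open>j \<in> J\<close> of the powers \<open>v j ^ q j\<close>. Only finitely many exponents may be nonzero;
  factors with exponent zero are 1 and left out, so that \<open>J\<close> itself may be infinite.\<close>

definition prod_pow :: "('j \<Rightarrow> 'v) \<Rightarrow> 'j set \<Rightarrow> ('j \<Rightarrow> rat) \<Rightarrow> ('v, 'k::field_char_0) qpoly" where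
  "prod_pow v J q = (\<Prod>j\<in>{j \<in> J. q j \<noteq> 0}. indet_pow (v j) (q j))"

text \<open>Substitution of the monomial with exponent vector \<open>\<sigma> t\<close> for every indeterminate \<open>t\<close>.\<close>

definition subst_exponent :: "('v \<Rightarrow> 'v \<Rightarrow>\<^sub>0 rat) \<Rightarrow> ('v \<Rightarrow>\<^sub>0 rat) \<Rightarrow> ('v \<Rightarrow>\<^sub>0 rat)" where
  "subst_exponent \<sigma> u = (\<Sum>t\<in>Poly_Mapping.keys u. scale (Poly_Mapping.lookup u t) (\<sigma> t))"

definition subst_monomials ::
  "('v \<Rightarrow> 'v \<Rightarrow>\<^sub>0 rat) \<Rightarrow> ('v, 'k) qpoly \<Rightarrow> ('v, 'k::field_char_0) qpoly" where
  "subst_monomials \<sigma> p =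
     (\<Sum>u\<in>Poly_Mapping.keys p. Poly_Mapping.single (subst_exponent \<sigma> u) (Poly_Mapping.lookup p u))"

definition set_to_one :: "'v set \<Rightarrow> ('v, 'k) qpoly \<Rightarrow> ('v, 'k::field_char_0) qpoly" where
  "set_to_one V = subst_monomials (\<lambda>t. if t \<in> V then 0 else Poly_Mapping.single t 1)"

text \<open>The substitution \<open>y\<^sub>j \<mapsto> y\<^sub>j / x\<^sub>j\<close> for \<open>j \<in> JX\<close> and \<open>x\<^sub>j \<mapsto> x\<^sub>j / y\<^sub>j\<close> for \<open>j \<in> JY\<close>.\<close>

fun quotient_exponent :: "'j set \<Rightarrow> 'j set \<Rightarrow> 'j indet \<Rightarrow> ('j indet \<Rightarrow>\<^sub>0 rat)" where
  "quotient_exponent JX JY (X j) =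
     (if j \<in> JY then Poly_Mapping.single (X j) 1 - Poly_Mapping.single (Y j) 1
      else Poly_Mapping.single (X j) 1)"
| "quotient_exponent JX JY (Y j) =
     (if j \<in> JX then Poly_Mapping.single (Y j) 1 - Poly_Mapping.single (X j) 1
      else Poly_Mapping.single (Y j) 1)"

definition subst_quotients ::
  "'j set \<Rightarrow> 'j set \<Rightarrow> ('j indet, 'k) qpoly \<Rightarrow> ('j indet, 'k::field_char_0) qpoly" where
  "subst_quotients JX JY = subst_monomials (quotient_exponent JX JY)"

section \<open>Coproduct, convolution and the canonical Tutte polynomial\<close>

definition coproduct :: "('s, 'e) minors \<Rightarrow> ('s \<Rightarrow>\<^sub>0 'k) \<Rightarrow> ('s \<times> 's \<Rightarrow>\<^sub>0 'k::field_char_0)" where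
  "coproduct M = linear_extension
     (\<lambda>S. \<Sum>A\<in>Pow (ground M S). basis_elt (del_set M S (ground M S - A), con_set M S A))"

definition counit :: "('s, 'e) minors \<Rightarrow> ('s \<Rightarrow>\<^sub>0 'k) \<Rightarrow> 'k::field_char_0" where
  "counit M h = (\<Sum>S\<in>Poly_Mapping.keys h. if S \<in> grade M 0 then Poly_Mapping.lookup h S else 0)"

text \<open>\<open>m \<circ> (f \<otimes> g)\<close>, where \<open>m\<close> is the multiplication of the target algebra.\<close>

definition mult_tensor ::
  "(('s \<Rightarrow>\<^sub>0 'k) \<Rightarrow> ('v, 'k) qpoly) \<Rightarrow> (('s \<Rightarrow>\<^sub>0 'k) \<Rightarrow> ('v, 'k) qpoly) \<Rightarrow>
    ('s \<times> 's \<Rightarrow>\<^sub>0 'k) \<Rightarrow> ('v, 'k::field_char_0) qpoly" where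
  "mult_tensor f g = linear_extension (\<lambda>(S, T). f (basis_elt S) * g (basis_elt T))"

definition convolution ::
  "('s, 'e) minors \<Rightarrow> (('s \<Rightarrow>\<^sub>0 'k) \<Rightarrow> ('v, 'k) qpoly) \<Rightarrow> (('s \<Rightarrow>\<^sub>0 'k) \<Rightarrow> ('v, 'k) qpoly) \<Rightarrow>
    ('s \<Rightarrow>\<^sub>0 'k) \<Rightarrow> ('v, 'k::field_char_0) qpoly" where
  "convolution M f g = mult_tensor f g \<circ> coproduct M"

text \<open>The zeroth power is the counit, followed by the inclusion of the constants.\<close>

primrec convolution_power ::
  "('s, 'e) minors \<Rightarrow> (('s \<Rightarrow>\<^sub>0 'k) \<Rightarrow> ('v, 'k) qpoly) \<Rightarrow> nat \<Rightarrow>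
    ('s \<Rightarrow>\<^sub>0 'k) \<Rightarrow> ('v, 'k::field_char_0) qpoly" where
  "convolution_power M \<delta> 0 = (\<lambda>h. scale (counit M h) 1)"
| "convolution_power M \<delta> (Suc k) = convolution M \<delta> (convolution_power M \<delta> k)"

text \<open>For \<open>\<delta>\<close> vanishing on \<open>\<S>\<^sub>0\<close> only finitely many powers are nonzero on a given element of the Hopf
  algebra, and the sum over these is the whole series.\<close>

definition convolution_exp ::
  "('s, 'e) minors \<Rightarrow> (('s \<Rightarrow>\<^sub>0 'k) \<Rightarrow> ('v, 'k) qpoly) \<Rightarrow>
    ('s \<Rightarrow>\<^sub>0 'k) \<Rightarrow> ('v, 'k::field_char_0) qpoly" where
  "convolution_exp M \<delta> h =
     (\<Sum>k\<in>{k. convolution_power M \<delta> k h \<noteq> 0}. scale (1 / fact k) (convolution_power M \<delta> k h))"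

definition canonical_tutte ::
  "('s, 'e) minors \<Rightarrow> (('s \<Rightarrow>\<^sub>0 'k) \<Rightarrow> ('v, 'k) qpoly) \<Rightarrow> (('s \<Rightarrow>\<^sub>0 'k) \<Rightarrow> ('v, 'k) qpoly) \<Rightarrow>
    ('s \<Rightarrow>\<^sub>0 'k) \<Rightarrow> ('v, 'k::field_char_0) qpoly" where
  "canonical_tutte M \<delta>a \<delta>b = convolution M (convolution_exp M \<delta>a) (convolution_exp M \<delta>b)"

text \<open>The functional \<open>\<Sum>\<^sub>i a\<^sub>i \<delta>\<^sub>i\<close>, where \<open>\<delta>\<^sub>i\<close> is dual to \<open>s i\<close>. On a given element of the Hopf algebra
  only finitely many \<open>\<delta>\<^sub>i\<close> are nonzero, so \<open>I\<close> may be infinite.\<close>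

definition selector ::
  "('i \<Rightarrow> 's) \<Rightarrow> 'i set \<Rightarrow> ('i \<Rightarrow> ('v, 'k) qpoly) \<Rightarrow>
    ('s \<Rightarrow>\<^sub>0 'k) \<Rightarrow> ('v, 'k::field_char_0) qpoly" where
  "selector s I a h = (\<Sum>i\<in>{i \<in> I. dual (s i) h \<noteq> 0}. scale (dual (s i) h) (a i))"

definition deletion_contraction ::
  "('s, 'e) minors \<Rightarrow> (('s \<Rightarrow>\<^sub>0 'k) \<Rightarrow> ('v, 'k) qpoly) \<Rightarrow> (('s \<Rightarrow>\<^sub>0 'k) \<Rightarrow> ('v, 'k) qpoly) \<Rightarrow>
    ('s \<Rightarrow> ('v, 'k::field_char_0) qpoly) \<Rightarrow> bool" where
  "deletion_contraction M \<delta>a \<delta>b \<alpha> \<longleftrightarrow>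
     (\<forall>S\<in>grade M 0. \<alpha> S = 1) \<and>
     (\<forall>S\<in>elts M - grade M 0. \<forall>e\<in>ground M S.
        \<alpha> S = \<delta>b (basis_elt (con_set M S (ground M S - {e}))) * \<alpha> (del M S e)
             + \<delta>a (basis_elt (del_set M S (ground M S - {e}))) * \<alpha> (con M S e))"

end

theory Submission
  imports Defs
begin

text \<open>
  Evaluating the rank condition on one-element minors gives \<open>m\<^sub>i\<^sub>j = r\<^sub>j(S\<^sub>i)\<close>, so that every monomial
  \<open>w(S) = \<Prod>\<^sub>j v\<^sub>j ^ r\<^sub>j(S)\<close> satisfies \<open>w(S) = w(S \ {f | f \<noteq> e}) w(S/e)\<close>. By induction on \<open>A\<close>, minors
  commuting, \<open>w(S) = w(S \ A\<^sup>c) w(S/A)\<close>. Hence each of the \<open>n!\<close> orderings contributes \<open>w(S)\<close> to the \<open>n\<close>-th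
  convolution power, the exponential of the selector is \<open>w\<close> itself, and the canonical Tutte polynomial
  is \<open>\<Sum>\<^sub>A w\<^sub>a(S \ A\<^sup>c) w\<^sub>b(S/A)\<close>. Splitting this sum by whether \<open>e \<in> A\<close> gives the recurrence, which has only
  one solution; and as \<open>r\<^sub>j\<close> is additive under \<open>S \<mapsto> (S \ A\<^sup>c, S/A)\<close>, the substitution can be compared
  summand by summand.
\<close>

section \<open>Iterated minors\<close>

locale removal =
  fixes C :: "'s set" and gr :: "'s \<Rightarrow> 'e set" and rem :: "'s \<Rightarrow> 'e \<Rightarrow> 's"
  assumes gr_finite: "S \<in> C \<Longrightarrow> finite (gr S)"
    and rem_closed: "S \<in> C \<Longrightarrow> e \<in> gr S \<Longrightarrow> rem S e \<in> C"
    and gr_rem: "S \<in> C \<Longrightarrow> e \<in> gr S \<Longrightarrow> gr (rem S e) = gr S - {e}"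
    and rem_rem: "\<lbrakk>S \<in> C; e \<in> gr S; f \<in> gr S; e \<noteq> f\<rbrakk> \<Longrightarrow> rem (rem S e) f = rem (rem S f) e"
begin

definition rem_set :: "'s \<Rightarrow> 'e set \<Rightarrow> 's" where
  "rem_set S A = Finite_Set.fold (\<lambda>e T. rem T e) S A"

text \<open>The operations commute only on elements of their ground sets, whereas the library's theory of
  folds wants them to commute everywhere; so they are extended by the identity.\<close>

definition guarded :: "'e \<Rightarrow> 's \<Rightarrow> 's" where
  "guarded e T = (if T \<in> C \<and> e \<in> gr T then rem T e else T)"

lemma guarded_commute: "comp_fun_commute guarded"
proof
  fix x y
  have "guarded y (guarded x T) = guarded x (guarded y T)" for T
    by (cases "T \<in> C"; cases "x = y"; cases "x \<in> gr T"; cases "y \<in> gr T")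
      (auto simp: guarded_def rem_closed gr_rem rem_rem)
  then show "guarded y \<circ> guarded x = guarded x \<circ> guarded y"
    by auto
qed

text \<open>The ground set of \<open>T\<close> is carried through the induction because it is what
  puts the next element into \<open>gr T\<close>, where \<open>rem\<close> and
  \<open>guarded\<close> agree. With the converse below, both operations have the same fold
  graph.\<close>

lemma fold_graph_rem:
  assumes "fold_graph (\<lambda>e T. rem T e) S A T" "S \<in> C" "A \<subseteq> gr S"
  shows "fold_graph guarded S A T \<and> T \<in> C \<and> gr T = gr S - A"
  using assms
proof (induction rule: fold_graph.induct)
  case emptyI
  then show ?case by (simp add: fold_graph.emptyI)
next
  case (insertI e A T)
  then have IH: "fold_graph guarded S A T" "T \<in> C" "gr T = gr S - A"
    by auto
  with insertI have e: "e \<in> gr T"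
    by auto
  have "fold_graph guarded S (insert e A) (guarded e T)"
    using insertI.hyps(1) IH(1) by (rule fold_graph.insertI)
  moreover have "guarded e T = rem T e"
    using IH e by (simp add: guarded_def)
  ultimately show ?case
    using IH e by (auto simp: rem_closed gr_rem)
qed

lemma fold_graph_guarded:
  assumes "fold_graph guarded S A T" "S \<in> C" "A \<subseteq> gr S"
  shows "fold_graph (\<lambda>e T. rem T e) S A T \<and> T \<in> C \<and> gr T = gr S - A"
  using assms
proof (induction rule: fold_graph.induct)
  case emptyI
  then show ?case by (simp add: fold_graph.emptyI)
next
  case (insertI e A T)
  then have IH: "fold_graph (\<lambda>e T. rem T e) S A T" "T \<in> C" "gr T = gr S - A"
    by auto
  with insertI have e: "e \<in> gr T"
    by auto
  have "fold_graph (\<lambda>e T. rem T e) S (insert e A) (rem T e)"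
    using fold_graph.insertI[OF insertI.hyps(1) IH(1)] by simp
  moreover have "guarded e T = rem T e"
    using IH e by (simp add: guarded_def)
  ultimately show ?case
    using IH e by (auto simp: rem_closed gr_rem)
qed

lemma rem_set_eq_fold_guarded:
  assumes "S \<in> C" "A \<subseteq> gr S"
  shows "rem_set S A = Finite_Set.fold guarded S A"
proof -
  \<comment> \<open>A fold depends on its operation only through the fold graph, so equal graphs
    give equal folds although \<open>rem\<close> need not commute globally.\<close>
  have "fold_graph (\<lambda>e T. rem T e) S A = fold_graph guarded S A"
    using fold_graph_rem fold_graph_guarded assms by (intro ext) blast
  then show ?thesis
    by (simp add: rem_set_def Finite_Set.fold_def)
qed

lemma rem_set_empty: "rem_set S {} = S"
  by (simp add: rem_set_def)

lemma
  assumes "S \<in> C" "A \<subseteq> gr S"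
  shows rem_set_closed: "rem_set S A \<in> C"
    and gr_rem_set: "gr (rem_set S A) = gr S - A"
proof -
  interpret comp_fun_commute guarded by (rule guarded_commute)
  have "finite A"
    using finite_subset[OF assms(2) gr_finite[OF assms(1)]] by simp
  then have "fold_graph guarded S A (rem_set S A)"
    using assms by (simp add: rem_set_eq_fold_guarded fold_graph_fold)
  then show "rem_set S A \<in> C" "gr (rem_set S A) = gr S - A"
    using fold_graph_guarded assms by blast+
qed

lemma rem_set_insert:
  assumes "S \<in> C" "insert e A \<subseteq> gr S" "e \<notin> A"
  shows "rem_set S (insert e A) = rem (rem_set S A) e"
proof -
  interpret comp_fun_commute guarded by (rule guarded_commute)
  have "finite A"
    using finite_subset[OF assms(2) gr_finite[OF assms(1)]] by simp
  moreover have "rem_set S A \<in> C" "e \<in> gr (rem_set S A)"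
    using assms by (auto simp: rem_set_closed gr_rem_set)
  moreover have "rem_set S (insert e A) = guarded e (rem_set S A)"
    using \<open>finite A\<close> assms by (simp add: rem_set_eq_fold_guarded)
  ultimately show ?thesis
    by (simp add: guarded_def)
qed

lemma rem_set_rem_set:
  assumes "S \<in> C" "A \<union> B \<subseteq> gr S" "A \<inter> B = {}"
  shows "rem_set (rem_set S A) B = rem_set S (A \<union> B)"
proof -
  have "finite B"
    using finite_subset[OF assms(2) gr_finite[OF assms(1)]] by simp
  then show ?thesis
    using assms
  proof (induction B)
    case empty
    then show ?case by (simp add: rem_set_empty)
  next
    case (insert e B)
    then have "rem_set (rem_set S A) (insert e B) = rem (rem_set (rem_set S A) B) e"
      by (intro rem_set_insert) (auto simp: rem_set_closed gr_rem_set)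
    also have "\<dots> = rem (rem_set S (A \<union> B)) e"
      using insert by simp
    also have "\<dots> = rem_set S (insert e (A \<union> B))"
      using insert by (intro rem_set_insert[symmetric]) auto
    finally show ?case by simp
  qed
qed

lemma rem_set_singleton:
  assumes "S \<in> C" "e \<in> gr S"
  shows "rem_set S {e} = rem S e"
  using rem_set_insert[of S e "{}"] assms by (simp add: rem_set_empty)

lemma rem_set_rem:
  assumes "S \<in> C" "insert e A \<subseteq> gr S" "e \<notin> A"
  shows "rem_set (rem S e) A = rem_set S (insert e A)"
  using rem_set_rem_set[of S "{e}" A] assms by (simp add: rem_set_singleton)

text \<open>Here \<open>h\<close> stands for the other minor operation at the fixed element
  \<open>e\<close>. Keeping it abstract lets one induction move deletions past a contraction and
  contractions past a deletion.\<close>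

lemma rem_set_commute:
  assumes "S \<in> C" "insert e A \<subseteq> gr S" "e \<notin> A"
    and op: "\<And>T. T \<in> C \<Longrightarrow> e \<in> gr T \<Longrightarrow> h T \<in> C \<and> gr (h T) = gr T - {e}"
    and commute: "\<And>T f. \<lbrakk>T \<in> C; e \<in> gr T; f \<in> gr T; f \<noteq> e\<rbrakk> \<Longrightarrow> h (rem T f) = rem (h T) f"
  shows "rem_set (h S) A = h (rem_set S A)"
proof -
  have "finite A"
    using finite_subset[OF assms(2) gr_finite[OF assms(1)]] by simp
  then show ?thesis
    using assms(1-3)
  proof (induction A)
    case empty
    then show ?case by (simp add: rem_set_empty)
  next
    case (insert f A)
    have hS: "h S \<in> C" "gr (h S) = gr S - {e}"
      using op insert.prems by auto
    have A: "e \<in> gr S" "f \<in> gr S" "A \<subseteq> gr S" "e \<noteq> f" "e \<notin> A"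
      using insert.prems by auto
    have "rem_set (h S) (insert f A) = rem (rem_set (h S) A) f"
      using hS A insert.hyps by (intro rem_set_insert) auto
    also have "\<dots> = rem (h (rem_set S A)) f"
      using insert.IH insert.prems by simp
    also have "\<dots> = h (rem (rem_set S A) f)"
      using A insert.hyps insert.prems(1)
      by (intro commute[symmetric]) (auto simp: rem_set_closed gr_rem_set)
    also have "rem (rem_set S A) f = rem_set S (insert f A)"
      using A insert.hyps insert.prems(1) by (intro rem_set_insert[symmetric]) auto
    finally show ?case .
  qed
qed

end

section \<open>Deletion and contraction as two commuting removals\<close>

context minors_system
begin

lemma finite_ground: "S \<in> elts M \<Longrightarrow> finite (ground M S)"
  using ground_finite by (auto simp: elts_def)

lemma grade_iff: "S \<in> grade M n \<longleftrightarrow> S \<in> elts M \<and> card (ground M S) = n"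
  using ground_card by (auto simp: elts_def)

lemma grade_0_iff: "S \<in> grade M 0 \<longleftrightarrow> S \<in> elts M \<and> ground M S = {}"
  using finite_ground by (auto simp: grade_iff)

sublocale del: removal "elts M" "ground M" "del M"
  by unfold_locales (simp_all add: finite_ground del_closed ground_del del_del)

sublocale con: removal "elts M" "ground M" "con M"
  by unfold_locales (simp_all add: finite_ground con_closed ground_con con_con)

lemma del_set_eq: "del_set M = del.rem_set"
  by (intro ext) (simp add: del_set_def del.rem_set_def)

lemma con_set_eq: "con_set M = con.rem_set"
  by (intro ext) (simp add: con_set_def con.rem_set_def)

lemmas del_set_simps = del.rem_set_empty[folded del_set_eq] del.rem_set_closed[folded del_set_eq]
  del.gr_rem_set[folded del_set_eq]
lemmas con_set_simps = con.rem_set_empty[folded con_set_eq] con.rem_set_closed[folded con_set_eq]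
  con.gr_rem_set[folded con_set_eq]
lemmas del_set_del_set = del.rem_set_rem_set[folded del_set_eq]
lemmas con_set_con_set = con.rem_set_rem_set[folded con_set_eq]
lemmas del_set_del = del.rem_set_rem[folded del_set_eq]
lemmas con_set_con = con.rem_set_rem[folded con_set_eq]
lemmas con_set_singleton = con.rem_set_singleton[folded con_set_eq]

lemma del_set_con:
  assumes "S \<in> elts M" "insert e A \<subseteq> ground M S" "e \<notin> A"
  shows "del_set M (con M S e) A = con M (del_set M S A) e"
  unfolding del_set_eq using assms
  by (intro del.rem_set_commute) (auto simp: con_closed ground_con del_con)

lemma con_set_del:
  assumes "S \<in> elts M" "insert e A \<subseteq> ground M S" "e \<notin> A"
  shows "con_set M (del M S e) A = del M (con_set M S A) e"
  unfolding con_set_eq using assms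
  by (intro con.rem_set_commute) (auto simp: del_closed ground_del del_con)

section \<open>Multiplicative weights\<close>

text \<open>Abstracts the monomials with exponents \<open>r j S\<close>. The condition is
  multiplicativity along those terms of the coproduct that are indexed by one-element sets.\<close>

definition weight :: "('s \<Rightarrow> 'a::comm_monoid_mult) \<Rightarrow> bool" where
  "weight w \<longleftrightarrow> (\<forall>S\<in>grade M 0. w S = 1) \<and>
    (\<forall>S\<in>elts M. \<forall>e\<in>ground M S. w S = w (del_set M S (ground M S - {e})) * w (con M S e))"

lemma weight_split:
  assumes w: "weight w" and "S \<in> elts M" "A \<subseteq> ground M S"
  shows "w S = w (del_set M S (ground M S - A)) * w (con_set M S A)"
proof -
  have "finite A"
    using finite_subset[OF assms(3) finite_ground[OF assms(2)]] .
  then show ?thesis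
    using assms(2,3)
  proof (induction A arbitrary: S)
    case empty
    then have "del_set M S (ground M S) \<in> grade M 0"
      by (simp add: grade_0_iff del_set_simps)
    with w show ?case
      by (simp add: weight_def con_set_simps)
  next
    case (insert e A)
    let ?E = "ground M S" and ?B = "ground M S - insert e A"
    let ?T = "del_set M S ?B"
    have T: "?T \<in> elts M" "ground M ?T = insert e A"
      using insert.prems by (auto simp: del_set_simps)
    \<comment> \<open>The weight condition at \<open>e\<close> is used for \<open>?T\<close> and
      again for \<open>S\<close>. Both uses produce the same one-element minor on \<open>e\<close>,
      so the remaining factors can be compared by the induction hypothesis for the contraction of
      \<open>e\<close>.\<close>
    have "w ?T = w (del_set M ?T (insert e A - {e})) * w (con M ?T e)"
      using w T unfolding weight_def by (metis insertI1)
    also have "insert e A - {e} = A"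
      using insert.hyps by auto
    also have "del_set M ?T A = del_set M S (?E - {e})"
      using insert by (subst del_set_del_set) (auto intro!: arg_cong[where f = "del_set M S"])
    also have "con M ?T e = del_set M (con M S e) ?B"
      using insert by (subst del_set_con) auto
    finally have wT: "w ?T = w (del_set M S (?E - {e})) * w (del_set M (con M S e) ?B)" .
    have "w S = w (del_set M S (?E - {e})) * w (con M S e)"
      using w insert.prems unfolding weight_def by blast
    also have "w (con M S e) = w (del_set M (con M S e) (ground M (con M S e) - A)) *
        w (con_set M (con M S e) A)"
      using insert by (intro insert.IH) (auto simp: con_closed ground_con)
    also have "ground M (con M S e) - A = ?B"
      using insert by (auto simp: ground_con)
    also have "con_set M (con M S e) A = con_set M S (insert e A)"
      using insert by (intro con_set_con) auto
    finally show ?case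
      by (simp add: wT mult.assoc)
  qed
qed

text \<open>The dual of the defining condition: split at the complement of \<open>e\<close>, where
  only \<open>e\<close> itself is deleted.\<close>

lemma weight_del:
  assumes "weight w" "S \<in> elts M" "e \<in> ground M S"
  shows "w S = w (con_set M S (ground M S - {e})) * w (del M S e)"
proof -
  have "w S = w (del_set M S (ground M S - (ground M S - {e}))) * w (con_set M S (ground M S - {e}))"
    using assms by (intro weight_split) auto
  also have "ground M S - (ground M S - {e}) = {e}"
    using assms by auto
  also have "del_set M S {e} = del M S e"
    using assms by (simp add: del_set_eq del.rem_set_singleton)
  finally show ?thesis
    by (simp add: mult.commute)
qed

lemma weight_con:
  assumes "weight w" "S \<in> elts M" "e \<in> ground M S"
  shows "w S = w (del_set M S (ground M S - {e})) * w (con M S e)"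
  using assms unfolding weight_def by blast

section \<open>The deletion-contraction recurrence\<close>

text \<open>A single choice of \<open>e\<close> for each \<open>S\<close> already determines the
  values by induction on size. That all choices agree is a matter of existence.\<close>

lemma deletion_contraction_unique:
  assumes "deletion_contraction M \<delta>a \<delta>b \<alpha>" "deletion_contraction M \<delta>a \<delta>b \<beta>" "S \<in> elts M"
  shows "\<alpha> S = \<beta> S"
  using assms(3)
proof (induction "card (ground M S)" arbitrary: S)
  case 0
  then have "S \<in> grade M 0"
    by (simp add: grade_iff)
  then show ?case
    using assms(1,2) by (simp add: deletion_contraction_def)
next
  case (Suc n)
  then obtain e where e: "e \<in> ground M S"
    by (metis card_eq_0_iff ex_in_conv nat.simps(3))
  with Suc have "\<alpha> (del M S e) = \<beta> (del M S e)" "\<alpha> (con M S e) = \<beta> (con M S e)"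
    using finite_ground by (auto intro!: Suc.hyps(1) simp: del_closed con_closed ground_del ground_con)
  moreover have "S \<in> elts M - grade M 0"
    using Suc e by (auto simp: grade_0_iff)
  ultimately show ?case
    using assms(1,2) e unfolding deletion_contraction_def by metis
qed

lemma deletion_contraction_sum:
  assumes wa: "weight wa" and wb: "weight wb"
    and \<delta>a: "\<And>S. S \<in> grade M 1 \<Longrightarrow> \<delta>a (basis_elt S) = wa S"
    and \<delta>b: "\<And>S. S \<in> grade M 1 \<Longrightarrow> \<delta>b (basis_elt S) = wb S"
    and \<alpha>: "\<And>S. S \<in> elts M \<Longrightarrow>
      \<alpha> S = (\<Sum>A\<in>Pow (ground M S). wa (del_set M S (ground M S - A)) * wb (con_set M S A))"
  shows "deletion_contraction M \<delta>a \<delta>b \<alpha>"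
  unfolding deletion_contraction_def
proof (intro conjI ballI)
  fix S assume "S \<in> grade M 0"
  then show "\<alpha> S = 1"
    using wa wb by (simp add: \<alpha> grade_0_iff del_set_simps con_set_simps weight_def)
next
  fix S e assume "S \<in> elts M - grade M 0" and e: "e \<in> ground M S"
  then have S: "S \<in> elts M"
    by simp
  define E where "E = ground M S - {e}"
  have E: "ground M S = insert e E" "e \<notin> E" "finite E"
    using e finite_ground[OF S] by (auto simp: E_def)
  have ES: "E \<subseteq> ground M S" "ground M S - E = {e}"
    using E by auto
  have "del_set M S E \<in> grade M 1" "con_set M S E \<in> grade M 1"
    using S ES by (auto simp: grade_iff del_set_simps con_set_simps)
  then have d: "\<delta>a (basis_elt (del_set M S E)) = wa (del_set M S E)"
      "\<delta>b (basis_elt (con_set M S E)) = wb (con_set M S E)"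
    by (auto simp: \<delta>a \<delta>b)
  have delS: "del M S e \<in> elts M" "ground M (del M S e) = E"
    and conS: "con M S e \<in> elts M" "ground M (con M S e) = E"
    using S e by (auto simp: del_closed ground_del con_closed ground_con E_def)
  define F where "F A = wa (del_set M S (insert e E - A)) * wb (con_set M S A)" for A
  \<comment> \<open>Terms with \<open>e\<close> not in \<open>A\<close>: the first factor is already
    a minor of the deletion of \<open>e\<close>. In the second factor \<open>e\<close> survives, and
    \<open>weight_del\<close> splits off its one-element minor, which does not depend on
    \<open>A\<close>.\<close>
  have del: "F A = wb (con_set M S E) *
      (wa (del_set M (del M S e) (E - A)) * wb (con_set M (del M S e) A))" if "A \<subseteq> E" for A
  proof -
    let ?T = "con_set M S A"
    have A: "insert e E - A = insert e (E - A)" "e \<notin> A"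
      using E that by auto
    have T: "?T \<in> elts M" "ground M ?T = insert e (E - A)"
      using con_set_simps(2,3)[OF S, of A] E that by auto
    have "wb ?T = wb (con_set M ?T (ground M ?T - {e})) * wb (del M ?T e)"
      using T by (intro weight_del wb) auto
    also have "ground M ?T - {e} = E - A"
      using T E by auto
    also have "con_set M ?T (E - A) = con_set M S E"
      using E S that by (subst con_set_con_set) (auto simp: Un_absorb1)
    also have "del M ?T e = con_set M (del M S e) A"
      using E S that A by (subst con_set_del) auto
    finally have "wb ?T = wb (con_set M S E) * wb (con_set M (del M S e) A)" .
    moreover have "del_set M S (insert e E - A) = del_set M (del M S e) (E - A)"
      unfolding A using E S by (subst del_set_del) auto
    ultimately show ?thesis
      by (simp add: F_def mult_ac)
  qed
  \<comment> \<open>Terms containing \<open>e\<close>, the mirror image: now \<open>e\<close>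
    survives in the first factor, from which \<open>weight_con\<close> splits off a one-element
    minor independent of \<open>A\<close>.\<close>
  have con: "F (insert e A) = wa (del_set M S E) *
      (wa (del_set M (con M S e) (E - A)) * wb (con_set M (con M S e) A))" if "A \<subseteq> E" for A
  proof -
    let ?T = "del_set M S (E - A)"
    have A: "insert e E - insert e A = E - A" "e \<notin> A"
      using E that by auto
    have T: "?T \<in> elts M" "ground M ?T = insert e A"
      using del_set_simps(2,3)[OF S, of "E - A"] E that by auto
    have "wa ?T = wa (del_set M ?T (ground M ?T - {e})) * wa (con M ?T e)"
      using T by (intro weight_con wa) auto
    also have "ground M ?T - {e} = A"
      using T A by auto
    also have "del_set M ?T A = del_set M S E"
      using E S that by (subst del_set_del_set) (auto simp: Un_absorb2)
    also have "con M ?T e = del_set M (con M S e) (E - A)"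
      using E S that A by (subst del_set_con) auto
    finally have "wa ?T = wa (del_set M S E) * wa (del_set M (con M S e) (E - A))" .
    moreover have "con_set M S (insert e A) = con_set M (con M S e) A"
      using E S A that by (subst con_set_con) auto
    ultimately show ?thesis
      by (simp add: F_def mult_ac A)
  qed
  have "\<alpha> S = (\<Sum>A\<in>Pow (insert e E). F A)"
    using S E by (simp add: \<alpha> F_def)
  also have "\<dots> = (\<Sum>A\<in>Pow E. F A) + (\<Sum>A\<in>insert e ` Pow E. F A)"
    unfolding Pow_insert using E by (intro sum.union_disjoint) auto
  also have "(\<Sum>A\<in>insert e ` Pow E. F A) = (\<Sum>A\<in>Pow E. F (insert e A))"
    using E by (subst sum.reindex) (auto simp: inj_on_def)
  finally have "\<alpha> S = wb (con_set M S E) * \<alpha> (del M S e) + wa (del_set M S E) * \<alpha> (con M S e)"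
    by (simp add: \<alpha> delS conS del con sum_distrib_left)
  then show "\<alpha> S = \<delta>b (basis_elt (con_set M S (ground M S - {e}))) * \<alpha> (del M S e) +
      \<delta>a (basis_elt (del_set M S (ground M S - {e}))) * \<alpha> (con M S e)"
    by (simp add: d flip: E_def)
qed

end

section \<open>Linear extensions and substitutions\<close>

lemma lookup_scale: "Poly_Mapping.lookup (scale c p) x = c * Poly_Mapping.lookup p x"
  by (simp add: scale_def map.rep_eq when_def)

lemma scale_one [simp]: "scale 1 p = p"
  by (rule poly_mapping_eqI) (simp add: lookup_scale)

lemma scale_zero_left [simp]: "scale 0 p = 0"
  by (rule poly_mapping_eqI) (simp add: lookup_scale)

lemma scale_zero_right [simp]: "scale c 0 = 0"
  by (rule poly_mapping_eqI) (simp add: lookup_scale)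

lemma scale_add_left: "scale (c + d) p = scale c p + scale d p"
  by (rule poly_mapping_eqI) (simp add: lookup_scale lookup_add algebra_simps)

lemma scale_minus_right: "scale c (p - q) = scale c p - scale c q"
  by (rule poly_mapping_eqI) (simp add: lookup_scale lookup_minus algebra_simps)

lemma scale_single: "scale c (Poly_Mapping.single u d) = Poly_Mapping.single u (c * d)"
  by (rule poly_mapping_eqI) (simp add: lookup_scale lookup_single when_def)

text \<open>Supports of sums can shrink by cancellation; a common finite superset lets several
  elements be expanded over one index set.\<close>

lemma linear_extension_superset:
  assumes "finite F" "Poly_Mapping.keys h \<subseteq> F"
  shows "linear_extension g h = (\<Sum>S\<in>F. scale (Poly_Mapping.lookup h S) (g S))"
  unfolding linear_extension_def using assms
  by (intro sum.mono_neutral_left) (auto simp: in_keys_iff)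

lemma linear_extension_single: "linear_extension g (Poly_Mapping.single S c) = scale c (g S)"
  by (subst linear_extension_superset[where F = "{S}"]) auto

lemma linear_extension_basis_elt: "linear_extension g (basis_elt S) = g S"
  by (simp add: basis_elt_def linear_extension_single)

lemma linear_extension_zero: "linear_extension g 0 = 0"
  by (simp add: linear_extension_def)

lemma linear_extension_add:
  "linear_extension g (h + k) = linear_extension g h + linear_extension g k"
proof -
  let ?F = "Poly_Mapping.keys h \<union> Poly_Mapping.keys k"
  have "linear_extension g p = (\<Sum>S\<in>?F. scale (Poly_Mapping.lookup p S) (g S))"
    if "p \<in> {h, k, h + k}" for p
    using that keys_add[of h k] by (intro linear_extension_superset) auto
  then show ?thesis
    by (simp add: lookup_add scale_add_left sum.distrib)
qed

lemma linear_extension_sum: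
  "linear_extension g (\<Sum>x\<in>F. h x) = (\<Sum>x\<in>F. linear_extension g (h x))"
  by (induction F rule: infinite_finite_induct)
    (simp_all add: linear_extension_zero linear_extension_add)

lemma sum_single_lookup:
  "(\<Sum>u\<in>Poly_Mapping.keys p. Poly_Mapping.single u (Poly_Mapping.lookup p u)) = p"
  by (rule poly_mapping_eqI) (simp add: lookup_sum lookup_single when_def in_keys_iff)

lemma subst_exponent_eq: "subst_exponent \<sigma> = linear_extension \<sigma>"
  by (intro ext) (simp add: subst_exponent_def linear_extension_def)

lemma subst_monomials_eq:
  "subst_monomials \<sigma> = linear_extension (\<lambda>u. Poly_Mapping.single (subst_exponent \<sigma> u) 1)"
  by (intro ext) (simp add: subst_monomials_def linear_extension_def scale_single)

lemma subst_monomials_single: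
  "subst_monomials \<sigma> (Poly_Mapping.single u c) = Poly_Mapping.single (subst_exponent \<sigma> u) c"
  by (simp add: subst_monomials_eq linear_extension_single scale_single)

lemma subst_monomials_zero [simp]: "subst_monomials \<sigma> 0 = 0"
  by (simp add: subst_monomials_eq linear_extension_zero)

lemma subst_monomials_sum:
  "subst_monomials \<sigma> (\<Sum>x\<in>F. h x) = (\<Sum>x\<in>F. subst_monomials \<sigma> (h x))"
  by (simp add: subst_monomials_eq linear_extension_sum)

lemma subst_monomials_one [simp]: "subst_monomials \<sigma> 1 = 1"
  unfolding single_one[symmetric] subst_monomials_single
  by (simp add: subst_exponent_def)

text \<open>Expanding both factors into monomials reduces the claim to additivity of
  \<open>subst_exponent\<close>, which is itself a linear extension.\<close>

lemma subst_monomials_mult: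
  "subst_monomials \<sigma> (p * q) = subst_monomials \<sigma> p * subst_monomials \<sigma> q"
proof -
  let ?t = "\<lambda>p u. Poly_Mapping.single u (Poly_Mapping.lookup p u)"
  have mult: "subst_monomials \<sigma> (?t p u * ?t q v) = subst_monomials \<sigma> (?t p u) * subst_monomials \<sigma> (?t q v)"
    for u v
    by (simp add: mult_single subst_monomials_single subst_exponent_eq linear_extension_add)
  have "subst_monomials \<sigma> ((\<Sum>u\<in>Poly_Mapping.keys p. ?t p u) * (\<Sum>v\<in>Poly_Mapping.keys q. ?t q v)) =
      subst_monomials \<sigma> (\<Sum>u\<in>Poly_Mapping.keys p. ?t p u) *
      subst_monomials \<sigma> (\<Sum>v\<in>Poly_Mapping.keys q. ?t q v)"
    unfolding sum_product subst_monomials_sum mult ..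
  then show ?thesis
    by (simp only: sum_single_lookup)
qed

lemma subst_monomials_prod:
  "subst_monomials \<sigma> (\<Prod>x\<in>F. h x) = (\<Prod>x\<in>F. subst_monomials \<sigma> (h x))"
  by (induction F rule: infinite_finite_induct) (simp_all add: subst_monomials_mult)

section \<open>Products of powers of indeterminates\<close>

lemma indet_pow_zero [simp]: "indet_pow t 0 = 1"
  by (simp add: indet_pow_def)

lemma indet_pow_add: "indet_pow t (p + q) = indet_pow t p * indet_pow t q"
  by (simp add: indet_pow_def mult_single single_add)

lemma subst_monomials_indet_pow:
  "subst_monomials \<sigma> (indet_pow t q) = Poly_Mapping.single (scale q (\<sigma> t)) 1"
  by (simp add: indet_pow_def subst_monomials_single subst_exponent_eq linear_extension_single)

lemma prod_pow_superset:
  assumes "finite F" "F \<subseteq> K" "{j \<in> K. q j \<noteq> 0} \<subseteq> F"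
  shows "prod_pow v K q = (\<Prod>j\<in>F. indet_pow (v j) (q j))"
  unfolding prod_pow_def using assms by (intro prod.mono_neutral_left) auto

lemma prod_pow_cong:
  assumes "K = L" "\<And>j. j \<in> L \<Longrightarrow> p j = q j"
  shows "prod_pow v K p = prod_pow v L q"
  unfolding prod_pow_def using assms by (intro prod.cong) auto

lemma prod_pow_zero: "prod_pow v K (\<lambda>j. 0) = 1"
  by (simp add: prod_pow_def)

lemma prod_pow_add:
  assumes "finite {j \<in> K. p j \<noteq> 0}" "finite {j \<in> K. q j \<noteq> 0}"
  shows "prod_pow v K (\<lambda>j. p j + q j) = prod_pow v K p * prod_pow v K q"
proof -
  \<comment> \<open>The three supports may differ, for \<open>p j + q j\<close> can vanish; all
    three products are taken over this union.\<close>
  let ?F = "{j \<in> K. p j \<noteq> 0} \<union> {j \<in> K. q j \<noteq> 0}"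
  have *: "prod_pow v K q' = (\<Prod>j\<in>?F. indet_pow (v j) (q' j))"
    if "{j \<in> K. q' j \<noteq> 0} \<subseteq> ?F" for q'
    using assms that by (intro prod_pow_superset) auto
  show ?thesis
    by (subst (1 2 3) *) (auto simp: indet_pow_add prod.distrib)
qed

lemma prod_pow_minus:
  assumes "finite {j \<in> K. q j \<noteq> 0}"
  shows "prod_pow v K q * prod_pow v K (\<lambda>j. - q j) = 1"
  using prod_pow_add[of K q "\<lambda>j. - q j" v] assms by (simp add: prod_pow_zero)

lemma prod_pow_Un:
  assumes "finite {j \<in> K \<union> L. q j \<noteq> 0}" "K \<inter> L = {}"
  shows "prod_pow v (K \<union> L) q = prod_pow v K q * prod_pow v L q"
proof -
  have "{j \<in> K \<union> L. q j \<noteq> 0} = {j \<in> K. q j \<noteq> 0} \<union> {j \<in> L. q j \<noteq> 0}"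
    by auto
  with assms show ?thesis
    unfolding prod_pow_def by (auto intro!: prod.union_disjoint)
qed

lemma prod_if_mem:
  assumes "finite {j \<in> K. q j \<noteq> 0}"
  shows "(\<Prod>j\<in>{j \<in> K. q j \<noteq> 0}. if P j then f j else 1) = (\<Prod>j\<in>{j \<in> {j \<in> K. P j}. q j \<noteq> 0}. f j)"
proof -
  have *: "{j \<in> {j \<in> K. P j}. q j \<noteq> 0} = {j \<in> {j \<in> K. q j \<noteq> 0}. P j}"
    by auto
  show ?thesis
    unfolding * using assms by (rule prod.inter_filter[symmetric])
qed

lemma set_to_one_prod_pow:
  assumes "finite {j \<in> K. q j \<noteq> 0}"
  shows "set_to_one V (prod_pow v K q) = prod_pow v {j \<in> K. v j \<notin> V} q"
proof -
  \<comment> \<open>An indeterminate in \<open>V\<close> is sent to the zero exponent vector, so its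
    powers become 1 and drop out of the product.\<close>
  have *: "set_to_one V (indet_pow t c) = (if t \<notin> V then indet_pow t c else 1)" for t c
    unfolding set_to_one_def subst_monomials_indet_pow by (simp add: scale_single indet_pow_def)
  show ?thesis
    unfolding prod_pow_def prod_if_mem[OF assms, symmetric]
    by (simp add: set_to_one_def subst_monomials_prod *[unfolded set_to_one_def])
qed

section \<open>Effect of the quotient substitution on monomials\<close>

lemma subst_quotients_mult:
  "subst_quotients JX JY (p * q) = subst_quotients JX JY p * subst_quotients JX JY q"
  by (simp add: subst_quotients_def subst_monomials_mult)

lemma subst_quotients_sum:
  "subst_quotients JX JY (\<Sum>x\<in>F. h x) = (\<Sum>x\<in>F. subst_quotients JX JY (h x))"
  by (simp add: subst_quotients_def subst_monomials_sum)

lemma subst_quotients_prod: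
  "subst_quotients JX JY (\<Prod>x\<in>F. h x) = (\<Prod>x\<in>F. subst_quotients JX JY (h x))"
  by (simp add: subst_quotients_def subst_monomials_prod)

text \<open>The denominators are collected into a separate product with negated exponents, the form
  in which \<open>prod_pow_minus\<close> later cancels them.\<close>

lemma subst_quotients_prod_pow_X:
  assumes "finite {j \<in> K. q j \<noteq> 0}"
  shows "subst_quotients JX JY (prod_pow X K q) =
    prod_pow X K q * prod_pow Y {j \<in> K. j \<in> JY} (\<lambda>j. - q j)"
proof -
  have *: "subst_quotients JX JY (indet_pow (X j) c) =
      indet_pow (X j) c * (if j \<in> JY then indet_pow (Y j) (- c) else 1)" for j c
    unfolding subst_quotients_def subst_monomials_indet_pow
    by (simp add: scale_single scale_minus_right indet_pow_def mult_single single_uminus)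
  have "subst_quotients JX JY (prod_pow X K q) =
      (\<Prod>j\<in>{j \<in> K. q j \<noteq> 0}. indet_pow (X j) (q j) * (if j \<in> JY then indet_pow (Y j) (- q j) else 1))"
    by (simp add: prod_pow_def subst_quotients_prod *)
  then show ?thesis
    by (simp add: prod.distrib prod_if_mem[OF assms] prod_pow_def)
qed

lemma subst_quotients_prod_pow_Y:
  assumes "finite {j \<in> K. q j \<noteq> 0}"
  shows "subst_quotients JX JY (prod_pow Y K q) =
    prod_pow Y K q * prod_pow X {j \<in> K. j \<in> JX} (\<lambda>j. - q j)"
proof -
  have *: "subst_quotients JX JY (indet_pow (Y j) c) =
      indet_pow (Y j) c * (if j \<in> JX then indet_pow (X j) (- c) else 1)" for j c
    unfolding subst_quotients_def subst_monomials_indet_pow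
    by (simp add: scale_single scale_minus_right indet_pow_def mult_single single_uminus)
  have "subst_quotients JX JY (prod_pow Y K q) =
      (\<Prod>j\<in>{j \<in> K. q j \<noteq> 0}. indet_pow (Y j) (q j) * (if j \<in> JX then indet_pow (X j) (- q j) else 1))"
    by (simp add: prod_pow_def subst_quotients_prod *)
  then show ?thesis
    by (simp add: prod.distrib prod_if_mem[OF assms] prod_pow_def)
qed

section \<open>Convolution exponentials\<close>

lemma selector_basis_elt:
  fixes s :: "'i \<Rightarrow> 's" and a :: "'i \<Rightarrow> ('v, 'k::field_char_0) qpoly"
  assumes "inj_on s I" "i \<in> I"
  shows "selector s I a (basis_elt (s i)) = a i"
proof -
  have "{k \<in> I. dual (s k) (basis_elt (s i) :: 's \<Rightarrow>\<^sub>0 'k) \<noteq> 0} = {i}"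
    using assms by (auto simp: dual_def basis_elt_def lookup_single when_def dest: inj_onD)
  then show ?thesis
    by (simp add: selector_def) (simp add: dual_def basis_elt_def)
qed

lemma selector_basis_elt_zero:
  fixes s :: "'i \<Rightarrow> 's" and a :: "'i \<Rightarrow> ('v, 'k::field_char_0) qpoly"
  assumes "S \<notin> s ` I"
  shows "selector s I a (basis_elt S) = 0"
proof -
  have "{k \<in> I. dual (s k) (basis_elt S :: 's \<Rightarrow>\<^sub>0 'k) \<noteq> 0} = {}"
    using assms by (auto simp: dual_def basis_elt_def lookup_single when_def)
  then show ?thesis
    unfolding selector_def by simp
qed

lemma convolution_basis_elt:
  "convolution M f g (basis_elt S) = (\<Sum>A\<in>Pow (ground M S).
    f (basis_elt (del_set M S (ground M S - A))) * g (basis_elt (con_set M S A)))"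
  by (simp add: convolution_def coproduct_def mult_tensor_def linear_extension_basis_elt
      linear_extension_sum)

text \<open>Convolution powers carry the factorial as an element of the polynomial ring, while the
  exponential divides by it in the field; this lets the two cancel.\<close>

lemma scale_of_nat: "scale (of_nat n) (p :: ('v, 'k::field_char_0) qpoly) = of_nat n * p"
  unfolding scale_def mult_map_scale_conv_mult by simp

lemma scale_scale: "scale c (scale d p) = scale (c * d) p"
  by (rule poly_mapping_eqI) (simp add: lookup_scale mult.assoc)

context minors_system
begin

text \<open>One more convolution factor chooses the element to contract. An \<open>S\<close> with
  \<open>k + 1\<close> elements offers \<open>k + 1\<close> choices, each contributing
  \<open>fact k\<close> times \<open>w S\<close>; for any other size the contraction has the wrong
  size for the \<open>k\<close>-th power.\<close>

lemma convolution_power_basis_elt: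
  assumes w: "weight w"
    and \<delta>: "\<And>S. S \<in> elts M \<Longrightarrow> \<delta> (basis_elt S) = (if S \<in> grade M 1 then w S else 0)"
    and S: "S \<in> elts M"
  shows "convolution_power M \<delta> k (basis_elt S) =
    (if card (ground M S) = k then of_nat (fact k) * w S else 0)"
  using S
proof (induction k arbitrary: S)
  case 0
  then show ?case
    using w by (auto simp: counit_def basis_elt_def grade_iff weight_def)
next
  case (Suc k)
  let ?E = "ground M S"
  let ?F = "\<lambda>A. \<delta> (basis_elt (del_set M S (?E - A))) * convolution_power M \<delta> k (basis_elt (con_set M S A))"
  have E: "finite ?E"
    using Suc.prems by (rule finite_ground)
  have F: "?F {e} = (if card ?E = Suc k then of_nat (fact k) * w S else 0)" if e: "e \<in> ?E" for e
  proof -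
    have c: "card ?E = Suc (card (ground M (con M S e)))"
      using card.remove[OF E e] ground_con[OF Suc.prems e] by simp
    have "\<delta> (basis_elt (del_set M S (?E - {e}))) = w (del_set M S (?E - {e}))"
      using Suc.prems e by (simp add: \<delta> grade_iff del_set_simps double_diff)
    moreover have "convolution_power M \<delta> k (basis_elt (con_set M S {e})) =
        (if card ?E = Suc k then of_nat (fact k) * w (con M S e) else 0)"
      using Suc.prems e by (simp add: c con_set_singleton Suc.IH con_closed)
    ultimately show ?thesis
      using weight_con[OF w Suc.prems e] by (simp add: mult_ac)
  qed
  have "convolution_power M \<delta> (Suc k) (basis_elt S) = (\<Sum>A\<in>Pow ?E. ?F A)"
    by (simp add: convolution_basis_elt)
  \<comment> \<open>The first tensor factor has ground set \<open>A\<close>, and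
    \<open>\<delta>\<close> is supported in degree one, so only one-element sets \<open>A\<close>
    survive.\<close>
  also have "\<dots> = (\<Sum>A\<in>(\<lambda>e. {e}) ` ?E. ?F A)"
  proof (rule sum.mono_neutral_right)
    show "\<forall>A\<in>Pow ?E - (\<lambda>e. {e}) ` ?E. ?F A = 0"
    proof
      fix A assume A: "A \<in> Pow ?E - (\<lambda>e. {e}) ` ?E"
      then have "card A \<noteq> 1"
        by (auto simp: card_1_singleton_iff)
      then have "del_set M S (?E - A) \<notin> grade M 1"
        using A Suc.prems by (auto simp: grade_iff del_set_simps double_diff)
      then show "?F A = 0"
        using A Suc.prems by (simp add: \<delta> del_set_simps)
    qed
  qed (use E in auto)
  also have "\<dots> = (\<Sum>e\<in>?E. ?F {e})"
    by (subst sum.reindex) (auto simp: inj_on_def)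
  also have "\<dots> = of_nat (card ?E) * (if card ?E = Suc k then of_nat (fact k) * w S else 0)"
    using F by simp
  finally show ?case
    by (simp add: algebra_simps)
qed

lemma convolution_exp_basis_elt:
  assumes w: "weight w"
    and \<delta>: "\<And>S. S \<in> elts M \<Longrightarrow> \<delta> (basis_elt S) = (if S \<in> grade M 1 then w S else 0)"
    and S: "S \<in> elts M"
  shows "convolution_exp M \<delta> (basis_elt S) = w S"
proof -
  let ?p = "\<lambda>k. convolution_power M \<delta> k (basis_elt S)" and ?n = "card (ground M S)"
  have p: "?p k = (if ?n = k then of_nat (fact k) * w S else 0)" for k
    using w \<delta> S by (rule convolution_power_basis_elt)
  have n: "scale (1 / fact ?n) (?p ?n) = w S"
    unfolding p if_P[OF refl] scale_of_nat[symmetric] scale_scale by simp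
  \<comment> \<open>The defining index set is contained in \<open>{?n}\<close>; it is empty if
    \<open>w S\<close> is zero, and then the added term vanishes.\<close>
  have "convolution_exp M \<delta> (basis_elt S) = (\<Sum>k\<in>{?n}. scale (1 / fact k) (?p k))"
    unfolding convolution_exp_def
    by (rule sum.mono_neutral_left) (auto simp: p)
  with n show ?thesis
    by simp
qed

lemma canonical_tutte_basis_elt:
  assumes "weight wa" "weight wb" "S \<in> elts M"
    and "\<And>S. S \<in> elts M \<Longrightarrow> \<delta>a (basis_elt S) = (if S \<in> grade M 1 then wa S else 0)"
    and "\<And>S. S \<in> elts M \<Longrightarrow> \<delta>b (basis_elt S) = (if S \<in> grade M 1 then wb S else 0)"
  shows "canonical_tutte M \<delta>a \<delta>b (basis_elt S) =
    (\<Sum>A\<in>Pow (ground M S). wa (del_set M S (ground M S - A)) * wb (con_set M S A))"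
  unfolding canonical_tutte_def convolution_basis_elt using assms
  by (intro sum.cong refl) (auto simp: convolution_exp_basis_elt del_set_simps con_set_simps)

end

text \<open>The recurrence constrains values on \<open>elts M\<close> only, hence
  \<open>extensional\<close> in the uniqueness claim. The finiteness clause certifies that the
  prefactors are genuine products rather than the default value 1 of a product over an infinite
  set.\<close>

theorem theorem4p4:
  fixes M :: "('s, 'e) minors"
    and I :: "'i set" and s :: "'i \<Rightarrow> 's"
    and J JX JY JZ :: "'j set"
    and r :: "'j \<Rightarrow> 's \<Rightarrow> rat" and m :: "'i \<Rightarrow> 'j \<Rightarrow> rat"
    and \<delta>a \<delta>b \<delta>a' \<delta>b' :: "('s \<Rightarrow>\<^sub>0 'k::field_char_0) \<Rightarrow> ('j indet, 'k) qpoly"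
  assumes M: "minors_system_mult M"
    and S1: "bij_betw s I (grade M 1)"
    and m_fin: "\<And>i. i \<in> I \<Longrightarrow> finite {j \<in> J. m i j \<noteq> 0}"
    and r_0: "\<And>j S. j \<in> J \<Longrightarrow> S \<in> grade M 0 \<Longrightarrow> r j S = 0"
    and r_con: "\<And>i j S e. \<lbrakk>i \<in> I; j \<in> J; S \<in> elts M; e \<in> ground M S;
        dual (s i) (basis_elt (del_set M S (ground M S - {e}))) = (1 :: 'k)\<rbrakk>
        \<Longrightarrow> r j S = r j (con M S e) + m i j"
    and \<delta>a: "\<delta>a = selector s I (\<lambda>i. prod_pow X J (m i))"
    and \<delta>b: "\<delta>b = selector s I (\<lambda>i. prod_pow Y J (m i))"
    and J_partition: "J = JX \<union> JY \<union> JZ"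
      "JX \<inter> JY = {}" "JX \<inter> JZ = {}" "JY \<inter> JZ = {}"
    and \<delta>a': "\<delta>a' = set_to_one (X ` JX) \<circ> \<delta>a"
    and \<delta>b': "\<delta>b' = set_to_one (Y ` JY) \<circ> \<delta>b"
  shows "(\<exists>!\<alpha>. \<alpha> \<in> extensional (elts M) \<and> deletion_contraction M \<delta>a \<delta>b \<alpha>) \<and>
    (\<forall>\<alpha>. deletion_contraction M \<delta>a \<delta>b \<alpha> \<longrightarrow> (\<forall>S\<in>elts M.
      finite {j \<in> JX \<union> JY. r j S \<noteq> 0} \<and>
      \<alpha> S = prod_pow X JX (\<lambda>j. r j S) * prod_pow Y JY (\<lambda>j. r j S)
            * subst_quotients JX JY (canonical_tutte M \<delta>a' \<delta>b' (basis_elt S))))"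
proof -
  interpret minors_system M
    using M by (rule minors_system_mult.axioms)
  have s: "inj_on s I" "s ` I = grade M 1"
    using S1 by (auto simp: bij_betw_def)
  have dual_self: "dual T (basis_elt T) = (1 :: 'k)" for T :: 's
    by (simp add: dual_def basis_elt_def)

  \<comment> \<open>Apply the rank condition to \<open>s i\<close> itself: nothing is deleted, and
    contracting its only element lands in grade 0, where \<open>r j\<close> vanishes.\<close>
  have r_grade_1: "r j (s i) = m i j" if i: "i \<in> I" and j: "j \<in> J" for i j
  proof -
    have si: "s i \<in> elts M" "card (ground M (s i)) = 1"
      using i s grade_iff[of "s i" 1] by auto
    then obtain e where e: "ground M (s i) = {e}"
      by (auto simp: card_1_singleton_iff)
    have "r j (s i) = r j (con M (s i) e) + m i j"
      using i j si e by (intro r_con) (auto simp: del_set_simps dual_self)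
    moreover have "con M (s i) e \<in> grade M 0"
      using si e by (simp add: grade_0_iff con_closed ground_con)
    ultimately show ?thesis
      using r_0 j by simp
  qed
  have del_set_grade_1: "del_set M S (ground M S - {e}) \<in> grade M 1"
    if "S \<in> elts M" "e \<in> ground M S" for S e
    using that by (auto simp: grade_iff del_set_simps double_diff)
  \<comment> \<open>Since \<open>s\<close> enumerates grade 1, the one-element minor is some
    \<open>s i\<close>, and \<open>m i j\<close> can be replaced by its rank.\<close>
  have r_split: "r j S = r j (del_set M S (ground M S - {e})) + r j (con M S e)"
    if j: "j \<in> J" and S: "S \<in> elts M" "e \<in> ground M S" for j S e
  proof -
    obtain i where i: "i \<in> I" "s i = del_set M S (ground M S - {e})"
      using del_set_grade_1[OF S] s(2) by (metis imageE)
    have "r j S = r j (con M S e) + m i j"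
      using i j S by (intro r_con) (auto simp: dual_self)
    then show ?thesis
      using r_grade_1[OF i(1) j] by (simp add: i)
  qed
  have r_finite_grade_1: "finite {j \<in> J. r j S \<noteq> 0}" if S: "S \<in> grade M 1" for S
  proof -
    obtain i where i: "i \<in> I" "s i = S"
      using S s(2) by (metis imageE)
    then have "{j \<in> J. r j S \<noteq> 0} = {j \<in> J. m i j \<noteq> 0}"
      using r_grade_1 by auto
    then show ?thesis
      using m_fin i by simp
  qed
  \<comment> \<open>Finite support is assumed for the \<open>m i\<close> only. By
    \<open>r_split\<close> it passes from one-element minors and the contraction to
    \<open>S\<close>.\<close>
  have r_finite: "finite {j \<in> J. r j S \<noteq> 0}" if "S \<in> elts M" for S
    using that
  proof (induction "card (ground M S)" arbitrary: S)
    case 0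
    then have "S \<in> grade M 0"
      by (simp add: grade_iff)
    then have "{j \<in> J. r j S \<noteq> 0} = {}"
      using r_0 by auto
    then show ?case by (simp only: finite.emptyI)
  next
    case (Suc n)
    then obtain e where e: "e \<in> ground M S"
      by (metis card_eq_0_iff ex_in_conv nat.simps(3))
    have "finite {j \<in> J. r j (con M S e) \<noteq> 0}"
      using Suc e finite_ground by (intro Suc.hyps(1)) (auto simp: con_closed ground_con)
    moreover have "finite {j \<in> J. r j (del_set M S (ground M S - {e})) \<noteq> 0}"
      using del_set_grade_1 Suc.prems e r_finite_grade_1 by blast
    moreover have "{j \<in> J. r j S \<noteq> 0} \<subseteq> {j \<in> J. r j (con M S e) \<noteq> 0} \<union>
        {j \<in> J. r j (del_set M S (ground M S - {e})) \<noteq> 0}"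
      using r_split[OF _ Suc.prems e] by auto
    ultimately show ?case
      using finite_subset by blast
  qed
  have r_finite': "finite {j \<in> K. r j S \<noteq> 0}" if "S \<in> elts M" "K \<subseteq> J" for S K
    using r_finite[OF that(1)] by (rule finite_subset[rotated]) (use that in auto)

  \<comment> \<open>The index set \<open>K\<close> will be \<open>J\<close> for the recurrence,
    \<open>J - JX\<close> and \<open>J - JY\<close> for the specialised functionals, and
    \<open>JX\<close> and \<open>JY\<close> for the prefactors.\<close>
  define w :: "('j \<Rightarrow> 'j indet) \<Rightarrow> 'j set \<Rightarrow> 's \<Rightarrow> ('j indet, 'k) qpoly"
    where "w v K S = prod_pow v K (\<lambda>j. r j S)" for v K S
  have weight: "weight (w v K)" if K: "K \<subseteq> J" for v K
    unfolding weight_def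
  proof (intro conjI ballI)
    fix S assume "S \<in> grade M 0"
    then have "w v K S = prod_pow v K (\<lambda>j. 0)"
      unfolding w_def using r_0 K by (intro prod_pow_cong) auto
    then show "w v K S = 1"
      by (simp add: prod_pow_zero)
  next
    fix S e assume S: "S \<in> elts M" "e \<in> ground M S"
    let ?T = "del_set M S (ground M S - {e})"
    have "w v K S = prod_pow v K (\<lambda>j. r j ?T + r j (con M S e))"
      unfolding w_def using r_split S K by (intro prod_pow_cong) auto
    also have "\<dots> = w v K ?T * w v K (con M S e)"
      unfolding w_def using S K by (intro prod_pow_add r_finite') (auto simp: del_set_simps con_closed)
    finally show "w v K S = w v K ?T * w v K (con M S e)" .
  qed

  have selector: "selector s I (\<lambda>i. prod_pow v J (m i)) (basis_elt S) =
      (if S \<in> grade M 1 then w v J S else 0)" for S and v :: "'j \<Rightarrow> 'j indet"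
  proof (cases "S \<in> grade M 1")
    case True
    then obtain i where i: "i \<in> I" "S = s i"
      using s(2) by (metis imageE)
    then have "selector s I (\<lambda>i. prod_pow v J (m i)) (basis_elt S) = prod_pow v J (m i)"
      using s(1) by (simp add: selector_basis_elt)
    also have "\<dots> = w v J S"
      unfolding w_def using i r_grade_1 by (intro prod_pow_cong) auto
    finally show ?thesis
      using True by simp
  next
    case False
    then show ?thesis
      using s(2) by (simp add: selector_basis_elt_zero)
  qed
  have set_to_one: "set_to_one (v ` L) (w v J S) = w v (J - L) S"
    if "inj v" "S \<in> elts M" for v L S
  proof -
    have "{j \<in> J. v j \<notin> v ` L} = J - L"
      using that(1) by (auto dest: injD)
    then show ?thesis
      using set_to_one_prod_pow[OF r_finite[OF that(2)], of "v ` L" v] by (simp add: w_def)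
  qed
  have set_to_one_0: "set_to_one V 0 = 0" for V :: "'j indet set"
    by (simp add: set_to_one_def)
  have inj: "inj X" "inj Y"
    by (auto simp: inj_def)
  have \<delta>a'_basis: "\<delta>a' (basis_elt S) = (if S \<in> grade M 1 then w X (J - JX) S else 0)"
    and \<delta>b'_basis: "\<delta>b' (basis_elt S) = (if S \<in> grade M 1 then w Y (J - JY) S else 0)"
    if "S \<in> elts M" for S
    using that by (simp_all add: \<delta>a' \<delta>b' \<delta>a \<delta>b selector set_to_one set_to_one_0 inj)

  \<comment> \<open>On \<open>elts M\<close> the candidate solution is the canonical Tutte
    polynomial of \<open>\<delta>a\<close> and \<open>\<delta>b\<close>, written out as a sum over
    subsets.\<close>
  define \<tau> where "\<tau> S = (\<Sum>A\<in>Pow (ground M S).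
    w X J (del_set M S (ground M S - A)) * w Y J (con_set M S A))" for S
  have dc: "deletion_contraction M \<delta>a \<delta>b \<alpha>" if "\<And>S. S \<in> elts M \<Longrightarrow> \<alpha> S = \<tau> S" for \<alpha>
    using that unfolding \<tau>_def
    by (intro deletion_contraction_sum[OF weight weight]) (auto simp: \<delta>a \<delta>b selector)
  have unique: "\<alpha> S = \<tau> S" if "deletion_contraction M \<delta>a \<delta>b \<alpha>" "S \<in> elts M" for \<alpha> S
    using that dc[of \<tau>] by (intro deletion_contraction_unique) auto

  have \<tau>: "\<tau> S = w X JX S * w Y JY S * subst_quotients JX JY (canonical_tutte M \<delta>a' \<delta>b' (basis_elt S))"
    if S: "S \<in> elts M" for S
  proof -
    \<comment> \<open>For \<open>j\<close> in \<open>JX\<close> the prefactor has \<open>x_j\<close>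
      to the power \<open>r j T + r j U\<close>. The denominators cancel the part from
      \<open>U\<close>, and the part from \<open>T\<close> restores what setting \<open>x_j\<close>
      to 1 had removed. For \<open>JY\<close> the roles of \<open>T\<close> and \<open>U\<close> are
      exchanged.\<close>
    have term_eq: "w X J T * w Y J U = w X JX S * w Y JY S *
        subst_quotients JX JY (w X (J - JX) T * w Y (J - JY) U)"
      if "A \<subseteq> ground M S" and T: "T = del_set M S (ground M S - A)" and U: "U = con_set M S A" for A T U
    proof -
      have TU: "T \<in> elts M" "U \<in> elts M"
        using S that by (auto simp: del_set_simps con_set_simps)
      have split: "w v K S = w v K T * w v K U" if "K \<subseteq> J" for v K
        using weight_split[OF weight[OF that] S \<open>A \<subseteq> ground M S\<close>] by (simp add: T U)
      have minus: "w v K V * prod_pow v K (\<lambda>j. - r j V) = 1" if "K \<subseteq> J" "V \<in> elts M" for v K V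
        unfolding w_def using that by (intro prod_pow_minus r_finite')
      have union: "w v J V = w v K V * w v (J - K) V" if "K \<subseteq> J" "V \<in> elts M" for v K V
      proof -
        have "w v (K \<union> (J - K)) V = w v K V * w v (J - K) V"
          unfolding w_def using that by (intro prod_pow_Un r_finite') auto
        moreover have "K \<union> (J - K) = J"
          using that by auto
        ultimately show ?thesis by simp
      qed
      \<comment> \<open>Disjointness of \<open>JX\<close> and \<open>JY\<close> enters here: every
        denominator needed for the cancellation really occurs.\<close>
      have K: "{j \<in> J - JX. j \<in> JY} = JY" "{j \<in> J - JY. j \<in> JX} = JX" "JX \<subseteq> J" "JY \<subseteq> J"
        using J_partition by auto
      have "subst_quotients JX JY (w X (J - JX) T * w Y (J - JY) U) =
          w X (J - JX) T * prod_pow Y JY (\<lambda>j. - r j T) * (w Y (J - JY) U * prod_pow X JX (\<lambda>j. - r j U))"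
        unfolding w_def subst_quotients_mult
          subst_quotients_prod_pow_X[OF r_finite'[OF TU(1) Diff_subset]]
          subst_quotients_prod_pow_Y[OF r_finite'[OF TU(2) Diff_subset]] K ..
      then have "w X JX S * w Y JY S * subst_quotients JX JY (w X (J - JX) T * w Y (J - JY) U) =
          (w X JX U * prod_pow X JX (\<lambda>j. - r j U)) * (w Y JY T * prod_pow Y JY (\<lambda>j. - r j T)) *
          ((w X JX T * w X (J - JX) T) * (w Y JY U * w Y (J - JY) U))"
        by (simp only: split[OF K(3)] split[OF K(4)] mult_ac)
      also have "\<dots> = w X J T * w Y J U"
        using TU K by (simp add: minus flip: union)
      finally show ?thesis ..
    qed
    have "canonical_tutte M \<delta>a' \<delta>b' (basis_elt S) = (\<Sum>A\<in>Pow (ground M S).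
        w X (J - JX) (del_set M S (ground M S - A)) * w Y (J - JY) (con_set M S A))"
      using S \<delta>a'_basis \<delta>b'_basis by (intro canonical_tutte_basis_elt weight) auto
    then have "w X JX S * w Y JY S * subst_quotients JX JY (canonical_tutte M \<delta>a' \<delta>b' (basis_elt S)) =
        (\<Sum>A\<in>Pow (ground M S). w X JX S * w Y JY S * subst_quotients JX JY
          (w X (J - JX) (del_set M S (ground M S - A)) * w Y (J - JY) (con_set M S A)))"
      by (simp only: subst_quotients_sum sum_distrib_left)
    also have "\<dots> = \<tau> S"
      unfolding \<tau>_def by (intro sum.cong refl term_eq[symmetric]) auto
    finally show ?thesis ..
  qed

  have "\<exists>!\<alpha>. \<alpha> \<in> extensional (elts M) \<and> deletion_contraction M \<delta>a \<delta>b \<alpha>"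
  proof (rule ex1I)
    show "restrict \<tau> (elts M) \<in> extensional (elts M) \<and>
        deletion_contraction M \<delta>a \<delta>b (restrict \<tau> (elts M))"
      by (auto intro: dc)
    show "\<alpha> = restrict \<tau> (elts M)"
      if "\<alpha> \<in> extensional (elts M) \<and> deletion_contraction M \<delta>a \<delta>b \<alpha>" for \<alpha>
      using that unique by (auto intro!: extensionalityI[of _ "elts M"])
  qed
  moreover have "finite {j \<in> JX \<union> JY. r j S \<noteq> 0}" if "S \<in> elts M" for S
    using that J_partition(1) by (intro r_finite') auto
  moreover have "\<alpha> S = prod_pow X JX (\<lambda>j. r j S) * prod_pow Y JY (\<lambda>j. r j S)
      * subst_quotients JX JY (canonical_tutte M \<delta>a' \<delta>b' (basis_elt S))"
    if "deletion_contraction M \<delta>a \<delta>b \<alpha>" "S \<in> elts M" for \<alpha> S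
    using unique[OF that] \<tau>[OF that(2)] by (simp only: w_def)
  ultimately show ?thesis
    by blast
qed

end
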